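(* Let $\mathcal{H},\mathcal{H}'$ be finite-dimensional real Hilbert spaces, let $A\colon\mathcal{H}\rightrightarrows\mathcal{H}$ and $C\colon\mathcal{H}'\rightrightarrows\mathcal{H}'$ be maximally monotone, let $B\colon\mathcal{H}\to\mathcal{H}$ be monotone and $L$-Lipschitz continuous, and let $K\colon\mathcal{H}\to\mathcal{H}'$ be a linear operator with adjoint $K^*$. Suppose the primal inclusion $$0\in(A+B)(x)+K^*C(Kx)\subset\mathcal{H}$$ has at least one solution, and let $\tau,\sigma>0$ be such that $2\tau L+\tau\sigma\|K\|^2<1$. Given arbitrary initial points $x^{-1}=x^0\in\mathcal{H}$ and $y^0\in\mathcal{H}'$, define, for $k\geq0$, $$\begin{aligned} x^{k+1}&=J_{\tau A}\bigl(x^k-\tau K^*y^k-2\tau B(x^k)+\tau B(x^{k-1})\bigr),\\ y^{k+1}&=J_{\sigma C^{-1}}\bigl(y^k+\sigma K(2x^{k+1}-x^k)\bigr). \end{aligned}$$ Then the sequence $(x^k,y^k)$ converges to a solution $(x,y)\in\mathcal{H}\times\mathcal{H}'$ of the primal-dual inclusion $$\binom{0}{0}\in\begin{bmatrix}A+B&K^*\\-K&C^{-1}\end{bmatrix}\binom{x}{y},$$ that is, $0\in A(x)+B(x)+K^*y$ and $0\in -Kx+C^{-1}(y)$.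
   Context: A set-valued operator $A$ is monotone if $\langle x-u,y-v\rangle\geq0$ for all $y\in A(x)$, $v\in A(u)$, and maximally monotone if no monotone operator properly extends it. $C^{-1}(y)=\{x: y\in C(x)\}$ is the set-valued inverse. The resolvent is $J_A=(\mathrm{Id}+A)^{-1}$, single-valued with full domain when $A$ is maximally monotone. $\|K\|$ is the operator norm. *)

theory Defs
  imports "HOL-Analysis.Analysis" "HOL-Library.Set_Algebras"
begin

text \<open>
  A set-valued operator is a function \<open>'a \<Rightarrow> 'b set\<close>; a single-valued map \<open>B\<close> is the
  operator \<open>\<lambda>x. {B x}\<close>. Sums of sets are the Minkowski sums of \<^theory>\<open>HOL-Library.Set_Algebras\<close>.
\<close>

definition monotone_operator :: "('a::real_inner \<Rightarrow> 'a set) \<Rightarrow> bool" where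
  "monotone_operator A \<longleftrightarrow> (\<forall>x u. \<forall>y\<in>A x. \<forall>v\<in>A u. inner (x - u) (y - v) \<ge> 0)"

definition maximally_monotone :: "('a::real_inner \<Rightarrow> 'a set) \<Rightarrow> bool" where
  "maximally_monotone A \<longleftrightarrow> monotone_operator A \<and>
     (\<forall>A'. monotone_operator A' \<and> (\<forall>x. A x \<subseteq> A' x) \<longrightarrow> A' = A)"

definition inverse_operator :: "('a \<Rightarrow> 'b set) \<Rightarrow> 'b \<Rightarrow> 'a set" where
  "inverse_operator C y = {x. y \<in> C x}"

definition scale_operator :: "real \<Rightarrow> ('a \<Rightarrow> 'b::real_vector set) \<Rightarrow> 'a \<Rightarrow> 'b set" where
  "scale_operator t A x = (\<lambda>a. t *\<^sub>R a) ` A x"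

definition resolvent_operator :: "('a::real_vector \<Rightarrow> 'a set) \<Rightarrow> 'a \<Rightarrow> 'a set" where
  "resolvent_operator A = inverse_operator (\<lambda>x. {x} + A x)"

text \<open>
  The resolvent as a point-valued map. It is meaningful where \<^const>\<open>resolvent_operator\<close> is
  a singleton, which for maximally monotone operators is everywhere (Minty).
\<close>

definition resolvent :: "('a::real_vector \<Rightarrow> 'a set) \<Rightarrow> 'a \<Rightarrow> 'a" where
  "resolvent A z = the_elem (resolvent_operator A z)"

text \<open>
  Finite-dimensional real Hilbert spaces are types of class \<^class>\<open>real_inner\<close> with a finite
  basis. Unlike \<^class>\<open>euclidean_space\<close> this includes the zero space.
\<close>

definition finite_dimensional :: "'a::real_vector itself \<Rightarrow> bool" where
  "finite_dimensional (_ :: 'a itself) \<longleftrightarrow>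
     (\<exists>E :: 'a set. finite_dimensional_vector_space ((*\<^sub>R) :: real \<Rightarrow> 'a \<Rightarrow> 'a) E)"

end

theory Submission
  imports Defs
begin

text \<open>
  The resolvent steps say that suitable vectors lie in \<open>A (x (k+1))\<close> and in
  \<open>C\<^sup>-\<^sup>1 (y (k+1))\<close>; this uses Minty's theorem, that the resolvent of a maximally
  monotone operator is defined everywhere (\<open>Minty\<close>, \<open>resolvent_scale_in\<close>). Its core is a
  finite intersection statement for balls (\<open>finite_monotone_balls_intersect\<close>), from which
  compactness produces the required point.

  Write \<open>D = C\<^sup>-\<^sup>1\<close> and let \<open>(u, v)\<close> be a primal-dual solution. Comparing both inclusions
  with those of the solution, by monotonicity of \<open>A\<close>, \<open>D\<close> and \<open>B\<close>, gives a one-step estimate in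
  the quadratic form \<open>Q (p, q) = |p|\<^sup>2/\<tau> + |q|\<^sup>2/\<sigma> - 2\<langle>K p, q\<rangle>\<close>, the preconditioner of the
  Chambolle-Pock method, in which the two coupling terms with \<open>K\<close> cancel. The reflected
  term \<open>2 B (x k) - B (x (k-1))\<close> makes the error in \<open>B\<close> telescope up to a product of two
  successive increments, which the Lipschitz bound controls. Hence

    \<open>Q (z k - z) - 2\<langle>x k - u, B (x k) - B (x (k-1))\<rangle> + L |x k - x (k-1)|\<^sup>2\<close>,

  where \<open>z k = (x k, y k)\<close> and \<open>z = (u, v)\<close>, decreases by at least \<open>Q (dx, dy) - 2 L |dx|\<^sup>2\<close> in the
  step with increment \<open>(dx, dy)\<close> (\<open>energy_descent\<close>). The step size condition says exactly
  that the form \<open>Q (p, q) - 2 L |p|\<^sup>2\<close> is coercive when the coupling is estimated by the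
  operator norm (\<open>Q_coercive\<close>). It also bounds the energy below by a multiple of the squared
  distance to the solution (\<open>energy_lower_bound\<close>).

  So the iterates are bounded and their increments tend to 0. By compactness some subsequence
  converges, and since graphs of maximally monotone operators are closed, its limit is a solution
  (\<open>cluster_point_is_solution\<close>). The energy relative to this particular solution is
  decreasing and tends to 0 along the subsequence, hence tends to 0 altogether, and the whole
  sequence converges.
\<close>

section \<open>Finite-dimensional inner product spaces\<close>

text \<open>
  The coordinates with respect to such a basis replace the class \<^class>\<open>euclidean_space\<close>, which
  excludes the zero space. The basis may be empty.
\<close>

lemma finite_dimensional_orthonormal_basis:
  assumes "finite_dimensional TYPE('a::real_inner)"
  obtains E :: "'a::real_inner set" where "finite E" "\<And>e. e \<in> E \<Longrightarrow> norm e = 1"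
    "\<And>x. (\<Sum>e\<in>E. inner x e *\<^sub>R e) = x"
proof -
  obtain E0 :: "'a set" where E0: "finite_dimensional_vector_space ((*\<^sub>R) :: real \<Rightarrow> 'a \<Rightarrow> 'a) E0"
    using assms unfolding finite_dimensional_def by (elim exE)
  have finE0: "finite E0"
    by (rule finite_dimensional_vector_space.finite_Basis[OF E0])
  have spanE0: "span E0 = UNIV"
    by (rule finite_dimensional_vector_space.span_Basis[OF E0, folded span_raw_def])
  obtain F :: "'a set" where F: "finite F" "span F = UNIV" "pairwise orthogonal F"
    using basis_orthogonal[OF finE0] unfolding spanE0 by (elim exE conjE)
  define E where "E = (\<lambda>e. e /\<^sub>R norm e) ` (F - {0})"
  have fin: "finite E" using F(1) by (simp add: E_def)
  have unit: "norm e = 1" if "e \<in> E" for e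
    using that by (auto simp: E_def intro!: left_inverse)
  have orth: "inner e e' = 0" if "e \<in> E" "e' \<in> E" "e \<noteq> e'" for e e'
  proof -
    obtain f f' where f: "f \<in> F" "f' \<in> F" "e = f /\<^sub>R norm f" "e' = f' /\<^sub>R norm f'"
      using \<open>e \<in> E\<close> \<open>e' \<in> E\<close> by (auto simp: E_def)
    then have "f \<noteq> f'" using \<open>e \<noteq> e'\<close> by auto
    then have "inner f f' = 0"
      using F(3) f(1,2) by (auto simp: pairwise_def orthogonal_def)
    then show ?thesis using f by simp
  qed
  have "F \<subseteq> span E"
  proof
    fix f assume "f \<in> F"
    show "f \<in> span E"
    proof (cases "f = 0")
      case False
      then have "f /\<^sub>R norm f \<in> E" using \<open>f \<in> F\<close> by (auto simp: E_def)
      then have "norm f *\<^sub>R (f /\<^sub>R norm f) \<in> span E" by (intro span_scale span_base)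
      then show ?thesis using False by simp
    qed (simp add: span_zero)
  qed
  then have span: "span E = UNIV"
    using F(2) span_minimal[OF _ subspace_span, of F E] by auto
  have "(\<Sum>e\<in>E. inner x e *\<^sub>R e) = x" for x
  proof -
    obtain c where c: "x = (\<Sum>e\<in>E. c e *\<^sub>R e)"
      using span span_finite[OF fin] by blast
    have "inner x e = c e" if "e \<in> E" for e
    proof -
      have "inner x e = (\<Sum>e'\<in>E. c e' * inner e' e)"
        by (simp add: c inner_sum_left)
      also have "\<dots> = (\<Sum>e'\<in>E. if e' = e then c e else 0)"
        using that orth unit by (intro sum.cong) (auto simp: dot_square_norm)
      finally show ?thesis using that fin by simp
    qed
    then show ?thesis by (simp add: c)
  qed
  then show ?thesis using that fin unit by blast
qed

text \<open>
  A bounded set lies in a box spanned by an orthonormal basis. The box is a Minkowski sum of finitely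
  many segments, so it is compact.
\<close>

lemma finite_dimensional_compact:
  fixes S :: "'a::real_inner set"
  assumes "finite_dimensional TYPE('a)" "closed S" "bounded S"
  shows "compact S"
proof -
  obtain E :: "'a set" where E: "finite E" "\<And>e. e \<in> E \<Longrightarrow> norm e = 1"
    "\<And>x. (\<Sum>e\<in>E. inner x e *\<^sub>R e) = x"
    using finite_dimensional_orthonormal_basis[OF assms(1)] by blast
  obtain r where r: "\<And>x. x \<in> S \<Longrightarrow> norm x \<le> r"
    using assms(3) by (auto simp: bounded_iff)
  define box where "box F = (\<Sum>e\<in>F. (\<lambda>t. t *\<^sub>R e) ` {-r..r})" for F :: "'a set"
  have "compact (box F)" if "finite F" for F
    using that
  proof induction
    case empty
    then show ?case by (simp add: box_def set_zero)
  next
    case (insert e F)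
    have "compact ((\<lambda>t. t *\<^sub>R e) ` {-r..r})"
      by (intro compact_continuous_image continuous_intros compact_Icc)
    moreover have "box (insert e F) =
        {x + y |x y. x \<in> (\<lambda>t. t *\<^sub>R e) ` {-r..r} \<and> y \<in> box F}"
      using insert.hyps by (simp add: box_def set_plus_def) blast
    ultimately show ?case
      using compact_sums[OF _ insert.IH] by simp
  qed
  then have "compact (box E)" using E(1) by blast
  moreover have "S \<subseteq> box E"
  proof
    fix x assume "x \<in> S"
    have "\<bar>inner x e\<bar> \<le> r" if "e \<in> E" for e
      using Cauchy_Schwarz_ineq2[of x e] E(2)[OF that] r[OF \<open>x \<in> S\<close>] by simp
    then have "\<forall>e\<in>E. inner x e *\<^sub>R e \<in> (\<lambda>t. t *\<^sub>R e) ` {-r..r}"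
      by (force simp: abs_le_iff)
    then show "x \<in> box E"
      unfolding box_def set_sum_alt[OF E(1)] using E(3)[of x] by force
  qed
  ultimately show ?thesis
    using assms(2) closed_Int_compact[of S "box E"] by (simp add: Int_absorb2)
qed

lemma finite_dimensional_bounded_linear:
  fixes f :: "'a::real_inner \<Rightarrow> 'b::real_normed_vector"
  assumes "finite_dimensional TYPE('a)" "linear f"
  shows "bounded_linear f"
proof -
  obtain E :: "'a set" where E: "finite E" "\<And>e. e \<in> E \<Longrightarrow> norm e = 1"
    "\<And>x. (\<Sum>e\<in>E. inner x e *\<^sub>R e) = x"
    using finite_dimensional_orthonormal_basis[OF assms(1)] by blast
  have "norm (f x) \<le> norm x * (\<Sum>e\<in>E. norm (f e))" for x
  proof -
    have "f x = (\<Sum>e\<in>E. inner x e *\<^sub>R f e)"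
      by (subst E(3)[symmetric]) (simp add: linear_sum[OF assms(2)] linear_scale[OF assms(2)])
    also have "norm \<dots> \<le> (\<Sum>e\<in>E. norm (inner x e *\<^sub>R f e))"
      by (rule norm_sum)
    also have "\<dots> \<le> (\<Sum>e\<in>E. norm x * norm (f e))"
      using Cauchy_Schwarz_ineq2[of x] E(2)
      by (intro sum_mono) (auto intro!: mult_right_mono, metis mult.right_neutral)
    finally show ?thesis by (simp add: sum_distrib_left)
  qed
  then show ?thesis
    using assms(2) by (intro bounded_linear_intro[where K = "\<Sum>e\<in>E. norm (f e)"])
      (auto simp: linear_add linear_scale)
qed

text \<open>
  \<^const>\<open>adjoint\<close> is a choice among functions with this property; one is written down in an
  orthonormal basis.
\<close>

lemma finite_dimensional_adjoint:
  fixes f :: "'a::real_inner \<Rightarrow> 'b::real_inner"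
  assumes "finite_dimensional TYPE('a)" "linear f"
  shows "inner x (adjoint f y) = inner (f x) y"
proof -
  obtain E :: "'a set" where E: "\<And>x. (\<Sum>e\<in>E. inner x e *\<^sub>R e) = x"
    using finite_dimensional_orthonormal_basis[OF assms(1)] by blast
  have *: "inner (f x) y = inner x (\<Sum>e\<in>E. inner (f e) y *\<^sub>R e)" for x y
  proof -
    have "f x = (\<Sum>e\<in>E. inner x e *\<^sub>R f e)"
      by (subst E[symmetric]) (simp add: linear_sum[OF assms(2)] linear_scale[OF assms(2)])
    then show ?thesis
      by (simp add: inner_sum_left inner_sum_right mult.commute)
  qed
  then have "adjoint f = (\<lambda>y. \<Sum>e\<in>E. inner (f e) y *\<^sub>R e)"
    by (intro adjoint_unique allI)
  then show ?thesis
    using *[of x y, symmetric] by simp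
qed

section \<open>Maximal monotonicity and Minty's theorem\<close>

text \<open>
  Maximality is used only in this pointwise form: a pair that is monotonically related to the whole
  graph belongs to the graph, since otherwise it could be added to it.
\<close>

lemma maximally_monotone_iff:
  "maximally_monotone A \<longleftrightarrow> monotone_operator A \<and>
     (\<forall>x y. (\<forall>u. \<forall>v\<in>A u. inner (x - u) (y - v) \<ge> 0) \<longrightarrow> y \<in> A x)" (is "_ \<longleftrightarrow> _ \<and> ?M")
proof safe
  assume A: "maximally_monotone A"
  then show mono: "monotone_operator A" by (simp add: maximally_monotone_def)
  fix x y assume xy: "\<forall>u. \<forall>v\<in>A u. inner (x - u) (y - v) \<ge> 0"
  have xy': "inner (u - x) (v - y) \<ge> 0" if "v \<in> A u" for u v
    using xy[rule_format, OF that] by (metis inner_minus_left inner_minus_right minus_diff_eq)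
  define A' where "A' = A(x := insert y (A x))"
  have "monotone_operator A'"
    using mono xy xy' unfolding monotone_operator_def A'_def by auto
  moreover have "A u \<subseteq> A' u" for u
    by (auto simp: A'_def)
  ultimately have "A' = A" using A by (simp add: maximally_monotone_def)
  then show "y \<in> A x" by (metis A'_def fun_upd_same insertI1)
next
  assume mono: "monotone_operator A" and max: ?M
  have "A' = A" if A': "monotone_operator A'" "\<And>x. A x \<subseteq> A' x" for A'
  proof (intro ext equalityI subsetI)
    fix x y assume "y \<in> A' x"
    then have "\<forall>u. \<forall>v\<in>A u. inner (x - u) (y - v) \<ge> 0"
      using A' unfolding monotone_operator_def by blast
    then show "y \<in> A x" using max by blast
  qed (use A' in auto)
  then show "maximally_monotone A" using mono by (auto simp: maximally_monotone_def)
qed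

lemma maximally_monotone_monotoneD:
  assumes "maximally_monotone A" "y \<in> A x" "v \<in> A u"
  shows "inner (x - u) (y - v) \<ge> 0"
  using assms unfolding maximally_monotone_def monotone_operator_def by blast

lemma maximally_monotone_maximalD:
  assumes "maximally_monotone A" "\<And>u v. v \<in> A u \<Longrightarrow> inner (x - u) (y - v) \<ge> 0"
  shows "y \<in> A x"
  using assms unfolding maximally_monotone_iff by blast

lemma maximally_monotone_inverse:
  assumes "maximally_monotone A"
  shows "maximally_monotone (inverse_operator A)"
  unfolding maximally_monotone_iff
proof (intro conjI allI impI)
  show "monotone_operator (inverse_operator A)"
    unfolding monotone_operator_def inverse_operator_def
    using maximally_monotone_monotoneD[OF assms]
    by (subst inner_commute) blast
next
  fix y x assume "\<forall>v. \<forall>u\<in>inverse_operator A v. inner (y - v) (x - u) \<ge> 0"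
  then have "inner (x - u) (y - v) \<ge> 0" if "v \<in> A u" for u v
    using that by (subst inner_commute) (simp add: inverse_operator_def)
  then show "x \<in> inverse_operator A y"
    using maximally_monotone_maximalD[OF assms] by (simp add: inverse_operator_def)
qed

lemma maximally_monotone_scale:
  assumes "maximally_monotone A" "t > 0"
  shows "maximally_monotone (scale_operator t A)"
  unfolding maximally_monotone_iff
proof (intro conjI allI impI)
  show "monotone_operator (scale_operator t A)"
    using assms(2) maximally_monotone_monotoneD[OF assms(1)]
    unfolding monotone_operator_def scale_operator_def
    by (auto simp flip: scaleR_diff_right)
next
  fix x y assume xy: "\<forall>u. \<forall>v\<in>scale_operator t A u. 0 \<le> inner (x - u) (y - v)"
  have "y /\<^sub>R t \<in> A x"
  proof (rule maximally_monotone_maximalD[OF assms(1)])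
    fix u v assume "v \<in> A u"
    then have "0 \<le> inner (x - u) (y - t *\<^sub>R v)"
      using xy by (auto simp: scale_operator_def)
    also have "y - t *\<^sub>R v = t *\<^sub>R (y /\<^sub>R t - v)"
      using assms(2) by (simp add: scaleR_diff_right)
    finally show "inner (x - u) (y /\<^sub>R t - v) \<ge> 0"
      using assms(2) by (simp add: zero_le_mult_iff)
  qed
  then show "y \<in> scale_operator t A x"
    unfolding scale_operator_def using assms(2)
    by (intro image_eqI[of _ _ "y /\<^sub>R t"]) auto
qed

text \<open>
  For fixed \<open>u, w\<close> the inequality describes the closed ball with diameter from \<open>u\<close> to \<open>w\<close>; balls
  coming from an antitone relation have a common point. By minimax duality the smallest possible
  value over \<open>x\<close> of the largest \<open>\<langle>x - u, x - w\<rangle>\<close> equals the largest value, over convex weights, of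
  \<open>s - |(u + w)/2|\<^sup>2\<close>, where \<open>u, w, s\<close> are the weighted means of the \<open>u\<close>, the \<open>w\<close> and the
  \<open>\<langle>u, w\<rangle>\<close>. The dual problem is maximised over a compact hull. Its value is at most 0,
  because antitonicity passes to the hull as \<open>s \<le> \<langle>u, w\<rangle>\<close>. The first-order condition at
  the maximiser says that \<open>x = (u + w)/2\<close> is a common point.
\<close>

lemma finite_monotone_balls_intersect:
  fixes G :: "('a::real_inner \<times> 'a) set"
  assumes "finite G"
    and mono: "\<And>u w u' w'. (u, w) \<in> G \<Longrightarrow> (u', w') \<in> G \<Longrightarrow> inner (u - u') (w - w') \<le> 0"
  shows "\<exists>x. \<forall>(u, w)\<in>G. inner (x - u) (x - w) \<le> 0"
proof (cases "G = {}")
  case False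
  define lift where "lift = (\<lambda>(u::'a, w::'a). (u, w, inner u w))"
  define H where "H = convex hull (lift ` G)"
  define g where "g = (\<lambda>(u::'a, w::'a, s::real). s - (norm ((u + w) /\<^sub>R 2))\<^sup>2)"
  have "compact H" unfolding H_def
    using assms(1) by (intro finite_imp_compact_convex_hull finite_imageI)
  moreover have "H \<noteq> {}" using False by (simp add: H_def)
  moreover have "continuous_on H g" unfolding g_def
    by (auto simp: case_prod_unfold intro!: continuous_intros)
  ultimately obtain p where p: "p \<in> H" "\<And>q. q \<in> H \<Longrightarrow> g q \<le> g p"
    using continuous_attains_sup[of H g] by blast
  obtain u w s where p_eq: "p = (u, w, s)" by (cases p)
  define x where "x = (u + w) /\<^sub>R 2"
  \<comment> \<open>Antitonicity of two pairs says that their lifts satisfy an inequality that is affine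
     in each lift; so it extends to the hull first in one argument and then in the other.\<close>
  have halfspace: "convex {(u, w, s). s + t \<le> inner u b + inner a w}" for a b :: 'a and t :: real
  proof -
    have "{(u, w, s). s + t \<le> inner u b + inner a w} =
        {p. inner (-b, -a, 1) p \<le> - t}"
      by (auto simp: inner_commute)
    then show ?thesis by (simp only: convex_halfspace_le)
  qed
  have one: "s' + inner a b \<le> inner u' b + inner a w'"
    if "(u', w', s') \<in> H" "(a, b) \<in> G" for u' w' s' a b
  proof -
    have "H \<subseteq> {(u, w, s). s + inner a b \<le> inner u b + inner a w}"
      unfolding H_def
    proof (rule hull_minimal[OF image_subsetI])
      fix g assume "g \<in> G"
      then obtain u w where "g = (u, w)" "(u, w) \<in> G" by (cases g) auto
      then show "lift g \<in> {(u, w, s). s + inner a b \<le> inner u b + inner a w}"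
        using mono[OF _ that(2), of u w]
        by (simp add: lift_def inner_diff_left inner_diff_right)
    qed (rule halfspace)
    then show ?thesis using that(1) by auto
  qed
  have two: "H \<subseteq> {(u', w', s'). s' + s \<le> inner u' w + inner u w'}"
    unfolding H_def
  proof (rule hull_minimal[OF image_subsetI])
    fix g assume "g \<in> G"
    then obtain a b where "g = (a, b)" "(a, b) \<in> G" by (cases g) auto
    then show "lift g \<in> {(u', w', s'). s' + s \<le> inner u' w + inner u w'}"
      using one[of u w s a b] p(1) p_eq by (simp add: lift_def)
  qed (rule halfspace)
  have "s \<le> inner u w"
    using two p(1) p_eq by auto
  moreover have "inner u w \<le> (norm x)\<^sup>2"
  proof -
    have "(norm x)\<^sup>2 - inner u w = (norm ((u - w) /\<^sub>R 2))\<^sup>2"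
      unfolding x_def power2_norm_eq_inner
      by (simp add: algebra_simps inner_commute)
    then show ?thesis by (smt (verit) zero_le_power2)
  qed
  ultimately have gp: "s \<le> (norm x)\<^sup>2" by simp
  have "inner (x - a) (x - b) \<le> 0" if ab: "(a, b) \<in> G" for a b
  proof -
    define c where "c = (a + b) /\<^sub>R 2"
    define d where "d = inner a b - s - 2 * inner x (c - x)"
    have in_H: "(a, b, inner a b) \<in> H"
      unfolding H_def using ab by (intro hull_inc) (force simp: lift_def)
    have step: "d \<le> t * (norm (c - x))\<^sup>2" if t: "0 < t" "t \<le> 1" for t
    proof -
      have "(1 - t) *\<^sub>R p + t *\<^sub>R (a, b, inner a b) \<in> H"
        using p(1) in_H t convex_convex_hull[of "lift ` G", folded H_def]
        by (intro convexD) auto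
      from p(2)[OF this]
      have "s + t * (inner a b - s) - (norm (x + t *\<^sub>R (c - x)))\<^sup>2 \<le> s - (norm x)\<^sup>2"
        unfolding p_eq g_def x_def c_def by (simp add: algebra_simps)
      also have "(norm (x + t *\<^sub>R (c - x)))\<^sup>2 =
          (norm x)\<^sup>2 + t * (2 * inner x (c - x)) + t\<^sup>2 * (norm (c - x))\<^sup>2"
        unfolding power2_norm_eq_inner
        by (simp add: inner_add_left inner_add_right inner_commute power2_eq_square)
      finally have "t * d \<le> t * (t * (norm (c - x))\<^sup>2)"
        by (simp add: d_def algebra_simps power2_eq_square)
      then show ?thesis using t(1) by simp
    qed
    \<comment> \<open>This is the directional derivative of \<open>g\<close> at the maximiser; a positive one
       would contradict \<open>step\<close> at \<open>t = d / (2 n)\<close>.\<close>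
    have "d \<le> 0"
    proof (rule ccontr)
      assume "\<not> d \<le> 0"
      moreover define n where "n = (norm (c - x))\<^sup>2"
      ultimately have "0 < d" "d \<le> n" using step[of 1] by auto
      moreover from this have "0 < d / (2 * n)" "d / (2 * n) \<le> 1"
        by (simp_all add: pos_divide_le_eq)
      then have "d \<le> d / (2 * n) * n"
        using step[of "d / (2 * n)"] unfolding n_def by blast
      ultimately show False by simp
    qed
    moreover have "inner (x - a) (x - b) = d + (s - (norm x)\<^sup>2)"
      unfolding d_def c_def power2_norm_eq_inner by (simp add: algebra_simps inner_commute)
    ultimately show ?thesis using gp by simp
  qed
  then show ?thesis by auto
qed simp

text \<open>
  The wanted \<open>x\<close> must satisfy \<open>\<langle>x - u, (z - x) - v\<rangle> \<ge> 0\<close> for all \<open>(u, v)\<close> in the graph. Each of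
  these conditions puts \<open>x\<close> into a compact ball, finitely many of the balls intersect, hence all do.
\<close>

theorem Minty:
  fixes A :: "'a::real_inner \<Rightarrow> 'a set"
  assumes "finite_dimensional TYPE('a)" "maximally_monotone A"
  shows "\<exists>x. z - x \<in> A x"
proof -
  define D where "D = (\<lambda>(u, v). {x. inner (x - u) (x - (z - v)) \<le> 0})"
  define G where "G = {(u, v). v \<in> A u}"
  have D_ball: "D (u, v) \<subseteq> cball u (norm (z - v - u))" for u v
  proof
    fix x assume "x \<in> D (u, v)"
    then have "inner (x - u) (x - u) \<le> inner (x - u) (z - v - u)"
      by (simp add: D_def algebra_simps)
    also have "\<dots> \<le> norm (x - u) * norm (z - v - u)" by (rule norm_cauchy_schwarz)
    finally have "norm (x - u) \<le> norm (z - v - u)"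
      by (cases "x = u") (auto simp: dot_square_norm power2_eq_square)
    then show "x \<in> cball u (norm (z - v - u))" by (simp add: dist_norm norm_minus_commute)
  qed
  have compact: "compact (D g)" for g
  proof (cases g)
    case (Pair u v)
    have "closed (D (u, v))"
      unfolding D_def by (simp, intro closed_Collect_le continuous_intros)
    then show ?thesis
      using finite_dimensional_compact[OF assms(1)] bounded_subset[OF bounded_cball D_ball] Pair
      by blast
  qed
  have fip: "(\<Inter>g\<in>G'. D g) \<noteq> {}" if "finite G'" "G' \<subseteq> G" for G'
  proof -
    have "\<exists>x. \<forall>(u, w)\<in>(\<lambda>(u, v). (u, z - v)) ` G'. inner (x - u) (x - w) \<le> 0"
    proof (rule finite_monotone_balls_intersect)
      fix u w u' w' assume "(u, w) \<in> (\<lambda>(u, v). (u, z - v)) ` G'" "(u', w') \<in> (\<lambda>(u, v). (u, z - v)) ` G'"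
      then have "z - w \<in> A u" "z - w' \<in> A u'" using that(2) by (auto simp: G_def)
      then have "inner (u - u') ((z - w) - (z - w')) \<ge> 0"
        by (rule maximally_monotone_monotoneD[OF assms(2)])
      then show "inner (u - u') (w - w') \<le> 0" by (simp add: inner_diff_right)
    qed (use that in simp)
    then obtain x where "\<And>u v. (u, v) \<in> G' \<Longrightarrow> inner (x - u) (x - (z - v)) \<le> 0"
      by force
    then have "x \<in> (\<Inter>g\<in>G'. D g)" by (auto simp: D_def)
    then show ?thesis by blast
  qed
  have "(\<Inter>g\<in>G. D g) \<noteq> {}"
  proof (cases "G = {}")
    case False
    then obtain g where "g \<in> G" by blast
    have "D g \<inter> (\<Inter>g\<in>G. D g) \<noteq> {}"
    proof (rule compact_imp_fip_image[OF compact])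
      fix G' assume "finite G'" "G' \<subseteq> G"
      then show "D g \<inter> (\<Inter>g\<in>G'. D g) \<noteq> {}"
        using fip[of "insert g G'"] \<open>g \<in> G\<close> by simp
    qed (use compact in \<open>auto intro: compact_imp_closed\<close>)
    then show ?thesis by blast
  qed simp
  then obtain x where x: "\<And>u v. v \<in> A u \<Longrightarrow> inner (x - u) (x - (z - v)) \<le> 0"
    by (auto simp: D_def G_def)
  have "z - x \<in> A x"
  proof (rule maximally_monotone_maximalD[OF assms(2)])
    fix u v assume "v \<in> A u"
    from x[OF this] show "inner (x - u) (z - x - v) \<ge> 0"
      by (simp add: algebra_simps)
  qed
  then show ?thesis ..
qed

lemma resolvent_scale_in:
  fixes A :: "'a::real_inner \<Rightarrow> 'a set"
  assumes "finite_dimensional TYPE('a)" "maximally_monotone A" "t > 0"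
    and x: "x = resolvent (scale_operator t A) z"
  shows "(z - x) /\<^sub>R t \<in> A x"
proof -
  let ?T = "scale_operator t A"
  have T: "maximally_monotone ?T" using assms by (intro maximally_monotone_scale)
  have mem: "u \<in> resolvent_operator ?T z \<longleftrightarrow> z - u \<in> ?T u" for u
    by (auto simp: resolvent_operator_def inverse_operator_def set_plus_def algebra_simps)
      (metis add.commute diff_add_cancel)
  obtain u where u: "z - u \<in> ?T u" using Minty[OF assms(1) T] by blast
  have "resolvent_operator ?T z = {u}"
  proof (intro equalityI subsetI)
    fix w assume "w \<in> resolvent_operator ?T z"
    then have "inner (w - u) ((z - w) - (z - u)) \<ge> 0"
      using mem u by (intro maximally_monotone_monotoneD[OF T]) auto
    then have "inner (w - u) (w - u) \<le> 0" by (simp add: algebra_simps)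
    then show "w \<in> {u}" by (simp add: dot_square_norm)
  qed (use u mem in simp)
  then have "x = u" by (simp add: x resolvent_def)
  then obtain a where "a \<in> A x" "z - x = t *\<^sub>R a" using u by (auto simp: scale_operator_def)
  then show ?thesis using assms(3) by simp
qed

section \<open>The energy of the forward-reflected-backward primal-dual iteration\<close>

text \<open>
  The constant is the determinant of the form divided by its trace; it is a lower bound for the
  smallest eigenvalue.
\<close>

lemma quadratic_form_coercive:
  fixes a b \<kappa> :: real
  assumes "a > 0" "b > 0" "\<kappa>\<^sup>2 < a * b"
  obtains \<epsilon> where "\<epsilon> > 0" "\<And>s t. \<epsilon> * (s\<^sup>2 + t\<^sup>2) \<le> a * s\<^sup>2 - 2 * \<kappa> * (s * t) + b * t\<^sup>2"
proof
  define \<epsilon> where "\<epsilon> = (a * b - \<kappa>\<^sup>2) / (a + b)"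
  show "\<epsilon> > 0" using assms by (simp add: \<epsilon>_def)
  have "\<epsilon> * (a + b) = a * b - \<kappa>\<^sup>2" using assms by (simp add: \<epsilon>_def)
  then have det: "(a - \<epsilon>) * (b - \<epsilon>) = \<kappa>\<^sup>2 + \<epsilon>\<^sup>2"
    by (simp add: algebra_simps power2_eq_square)
  have "a - \<epsilon> = (a\<^sup>2 + \<kappa>\<^sup>2) / (a + b)"
    using assms by (simp add: \<epsilon>_def field_simps power2_eq_square)
  then have pos: "a - \<epsilon> > 0"
    using assms by (simp add: add_pos_nonneg)
  fix s t :: real
  have "(a - \<epsilon>) * ((a - \<epsilon>) * s\<^sup>2 - 2 * \<kappa> * (s * t) + (b - \<epsilon>) * t\<^sup>2) =
      ((a - \<epsilon>) * s - \<kappa> * t)\<^sup>2 + ((a - \<epsilon>) * (b - \<epsilon>) - \<kappa>\<^sup>2) * t\<^sup>2"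
    by (simp add: algebra_simps power2_eq_square)
  also have "\<dots> \<ge> 0" by (simp add: det)
  finally have "(a - \<epsilon>) * s\<^sup>2 - 2 * \<kappa> * (s * t) + (b - \<epsilon>) * t\<^sup>2 \<ge> 0"
    using pos by (simp add: zero_le_mult_iff)
  then show "\<epsilon> * (s\<^sup>2 + t\<^sup>2) \<le> a * s\<^sup>2 - 2 * \<kappa> * (s * t) + b * t\<^sup>2"
    by (simp add: algebra_simps)
qed

lemma tendsto_zero_of_power2_le:
  fixes f :: "nat \<Rightarrow> 'c::real_normed_vector"
  assumes "\<And>k. c * (norm (f k))\<^sup>2 \<le> g k" "c > 0" "g \<longlonglongrightarrow> 0"
  shows "f \<longlonglongrightarrow> 0"
proof -
  have "(\<lambda>k. g k / c) \<longlonglongrightarrow> 0"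
    using tendsto_divide_zero[OF assms(3)] .
  then have "(\<lambda>k. (norm (f k))\<^sup>2) \<longlonglongrightarrow> 0"
    by (rule tendsto_sandwich[OF _ _ tendsto_const, rotated 2])
      (use assms(1,2) in \<open>auto simp: pos_le_divide_eq mult.commute\<close>)
  then have "(\<lambda>k. sqrt ((norm (f k))\<^sup>2)) \<longlonglongrightarrow> sqrt 0"
    by (rule tendsto_real_sqrt)
  then show ?thesis by (simp add: tendsto_norm_zero_iff)
qed

text \<open>
  \<open>D\<close> is the inverse of the dual operator \<open>C\<close> and \<open>K'\<close> the adjoint of \<open>K\<close>. The primal
  sequence is indexed with a shift by one, so that \<open>x 0\<close>, \<open>x 1\<close> are the two initial points and
  \<open>x (Suc k)\<close> is the partner of \<open>y k\<close>. The two resolvent steps appear as inclusions.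
\<close>

locale forward_reflected_primal_dual =
  fixes A :: "'a::real_inner \<Rightarrow> 'a set"
    and B :: "'a \<Rightarrow> 'a"
    and D :: "'b::real_inner \<Rightarrow> 'b set"
    and K :: "'a \<Rightarrow> 'b"
    and K' :: "'b \<Rightarrow> 'a"
    and L \<tau> \<sigma> :: real
    and x :: "nat \<Rightarrow> 'a"
    and y :: "nat \<Rightarrow> 'b"
  assumes A_max: "maximally_monotone A"
    and D_max: "maximally_monotone D"
    and B_mono: "monotone_operator (\<lambda>u. {B u})"
    and B_lipschitz: "L-lipschitz_on UNIV B"
    and K_linear: "bounded_linear K"
    and K_adjoint: "inner u (K' v) = inner (K u) v"
    and tau_pos: "\<tau> > 0"
    and sigma_pos: "\<sigma> > 0"
    and step_size: "2 * \<tau> * L + \<tau> * \<sigma> * (onorm K)\<^sup>2 < 1"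
    and x_step: "(x (Suc k) - x (Suc (Suc k))) /\<^sub>R \<tau> - K' (y k) - 2 *\<^sub>R B (x (Suc k)) + B (x k)
        \<in> A (x (Suc (Suc k)))"
    and y_step: "(y k - y (Suc k)) /\<^sub>R \<sigma> + K (2 *\<^sub>R x (Suc (Suc k)) - x (Suc k)) \<in> D (y (Suc k))"
begin

interpretation K: bounded_linear K by (rule K_linear)

definition is_solution :: "'a \<Rightarrow> 'b \<Rightarrow> bool" where
  "is_solution u v \<longleftrightarrow> - B u - K' v \<in> A u \<and> K u \<in> D v"

definition Q :: "'a \<Rightarrow> 'b \<Rightarrow> real" where
  "Q u v = (norm u)\<^sup>2 / \<tau> + (norm v)\<^sup>2 / \<sigma> - 2 * inner (K u) v"

definition energy :: "'a \<Rightarrow> 'b \<Rightarrow> nat \<Rightarrow> real" where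
  "energy u v k = Q (x (Suc k) - u) (y k - v)
     - 2 * inner (x (Suc k) - u) (B (x (Suc k)) - B (x k))
     + L * (norm (x (Suc k) - x k))\<^sup>2"

lemma L_nonneg: "L \<ge> 0"
  using B_lipschitz by (rule lipschitz_on_nonneg)

text \<open>The Lipschitz bound followed by the arithmetic-geometric mean inequality.\<close>

lemma B_cross_term:
  "\<bar>2 * inner p (B u - B v)\<bar> \<le> L * ((norm p)\<^sup>2 + (norm (u - v))\<^sup>2)"
proof -
  have "\<bar>2 * inner p (B u - B v)\<bar> \<le> 2 * (norm p * norm (B u - B v))"
    using Cauchy_Schwarz_ineq2[of p "B u - B v"] by simp
  also have "\<dots> \<le> 2 * (norm p * (L * norm (u - v)))"
    using lipschitz_onD[OF B_lipschitz, of u v]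
    by (intro mult_left_mono) (auto simp: dist_norm)
  also have "\<dots> = L * (2 * norm p * norm (u - v))" by simp
  also have "\<dots> \<le> L * ((norm p)\<^sup>2 + (norm (u - v))\<^sup>2)"
    by (intro mult_left_mono sum_squares_bound L_nonneg)
  finally show ?thesis .
qed

text \<open>
  Estimating \<open>K\<close> by its norm reduces this to a form in \<open>norm u\<close> and \<open>norm v\<close> whose determinant
  is positive precisely by the step size condition.
\<close>

lemma Q_coercive:
  obtains \<epsilon> where "\<epsilon> > 0"
    "\<And>u v. \<epsilon> * ((norm u)\<^sup>2 + (norm v)\<^sup>2) \<le> Q u v - 2 * L * (norm u)\<^sup>2"
proof -
  define \<kappa> where "\<kappa> = onorm K"
  have ineq: "\<tau> * \<sigma> * \<kappa>\<^sup>2 < 1 - 2 * \<tau> * L" using step_size by (simp add: \<kappa>_def)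
  moreover have "0 \<le> \<tau> * \<sigma> * \<kappa>\<^sup>2" using tau_pos sigma_pos by simp
  ultimately have "0 < 1 - 2 * \<tau> * L" by linarith
  moreover have a: "1 / \<tau> - 2 * L = (1 - 2 * \<tau> * L) / \<tau>" using tau_pos by (simp add: field_simps)
  ultimately have a_pos: "1 / \<tau> - 2 * L > 0" using tau_pos by simp
  moreover have b_pos: "1 / \<sigma> > 0" using sigma_pos by simp
  moreover have "\<kappa>\<^sup>2 < (1 / \<tau> - 2 * L) * (1 / \<sigma>)"
    unfolding a using ineq tau_pos sigma_pos by (simp add: field_simps)
  ultimately obtain \<epsilon> where \<epsilon>: "\<epsilon> > 0"
    "\<And>s t. \<epsilon> * (s\<^sup>2 + t\<^sup>2) \<le> (1 / \<tau> - 2 * L) * s\<^sup>2 - 2 * \<kappa> * (s * t) + 1 / \<sigma> * t\<^sup>2"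
    using quadratic_form_coercive by blast
  have "\<epsilon> * ((norm u)\<^sup>2 + (norm v)\<^sup>2) \<le> Q u v - 2 * L * (norm u)\<^sup>2" for u v
  proof -
    have "inner (K u) v \<le> norm (K u) * norm v" by (rule norm_cauchy_schwarz)
    also have "\<dots> \<le> \<kappa> * norm u * norm v"
      unfolding \<kappa>_def by (intro mult_right_mono onorm K_linear) simp
    finally have "inner (K u) v \<le> \<kappa> * (norm u * norm v)" by (simp add: mult.assoc)
    then show ?thesis
      using \<epsilon>(2)[of "norm u" "norm v"] by (simp add: Q_def algebra_simps)
  qed
  then show ?thesis using that \<epsilon>(1) by blast
qed

lemma Q_diff:
  "Q (p - dx) (q - dy) = Q p q + Q dx dy
     - 2 * (inner p dx / \<tau> + inner q dy / \<sigma> - inner (K p) dy - inner (K dx) q)"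
  unfolding Q_def power2_norm_eq_inner
  by (simp add: K.diff inner_diff_left inner_diff_right inner_commute
      add_divide_distrib diff_divide_distrib algebra_simps)

text \<open>
  With \<open>p\<close>, \<open>q\<close> the errors after the step and \<open>b1\<close>, \<open>b2\<close> the increments of \<open>B\<close> before and
  after it, monotonicity of \<open>A\<close>, \<open>D\<close> and \<open>B\<close> gives three inequalities whose sum bounds the
  cross term in \<open>Q_diff\<close> by \<open>\<langle>p, b2 - b1\<rangle>\<close>. The parts \<open>\<langle>p, b2\<rangle>\<close> and
  \<open>\<langle>p - dx, b1\<rangle>\<close> belong to the new and the old energy, and what remains is
  \<open>\<langle>dx, b1\<rangle>\<close>, a product of increments.
\<close>

lemma energy_descent:
  assumes "is_solution u v"
  defines "dx k \<equiv> x (Suc (Suc k)) - x (Suc k)" and "dy k \<equiv> y (Suc k) - y k"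
  shows "energy u v (Suc k) + (Q (dx k) (dy k) - 2 * L * (norm (dx k))\<^sup>2) \<le> energy u v k"
proof -
  define p q where "p = x (Suc (Suc k)) - u" and "q = y (Suc k) - v"
  define b1 b2 where "b1 = B (x (Suc k)) - B (x k)"
    and "b2 = B (x (Suc (Suc k))) - B (x (Suc k))"
  have x_eq: "x (Suc k) - u = p - dx k" and y_eq: "y k - v = q - dy k"
    by (simp_all add: p_def q_def dx_def dy_def)
  have "0 \<le> inner p (((x (Suc k) - x (Suc (Suc k))) /\<^sub>R \<tau> - K' (y k)
      - 2 *\<^sub>R B (x (Suc k)) + B (x k)) - (- B u - K' v))"
    unfolding p_def using assms(1) x_step
    by (intro maximally_monotone_monotoneD[OF A_max]) (auto simp: is_solution_def)
  also have "\<dots> = inner p (- (inverse \<tau> *\<^sub>R dx k)) - inner p (K' (y k)) + inner p (K' v)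
      + inner p (B u - B (x (Suc (Suc k)))) + inner p b2 - inner p b1"
    unfolding b1_def b2_def dx_def
    by (simp add: inner_add_right inner_diff_right algebra_simps scaleR_2)
  also have "\<dots> = - (inner p (dx k) / \<tau>) - inner (K p) (q - dy k)
      + inner p (B u - B (x (Suc (Suc k)))) + inner p b2 - inner p b1"
    by (simp add: K_adjoint inner_diff_right divide_inverse flip: y_eq)
  finally have primal: "0 \<le> \<dots>" .
  have "0 \<le> inner q (((y k - y (Suc k)) /\<^sub>R \<sigma> + K (2 *\<^sub>R x (Suc (Suc k)) - x (Suc k))) - K u)"
    unfolding q_def using assms(1) y_step
    by (intro maximally_monotone_monotoneD[OF D_max]) (auto simp: is_solution_def)
  also have "((y k - y (Suc k)) /\<^sub>R \<sigma> + K (2 *\<^sub>R x (Suc (Suc k)) - x (Suc k))) - K u =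
      - (inverse \<sigma> *\<^sub>R dy k) + K p + K (dx k)"
    unfolding dy_def p_def dx_def
    by (simp add: K.diff K.add algebra_simps scaleR_2)
  also have "inner q \<dots> = - (inner q (dy k) / \<sigma>) + inner (K p) q + inner (K (dx k)) q"
    by (simp add: inner_add_right inner_diff_right inner_commute divide_inverse)
  finally have dual: "0 \<le> \<dots>" .
  have "0 \<le> inner p (B (x (Suc (Suc k))) - B u)"
    using B_mono by (simp add: monotone_operator_def p_def)
  then have B: "inner p (B u - B (x (Suc (Suc k)))) \<le> 0"
    by (simp add: inner_diff_right)
  have cross: "- (2 * inner (dx k) b1) \<le> L * (norm (dx k))\<^sup>2 + L * (norm (x (Suc k) - x k))\<^sup>2"
    using B_cross_term[of "dx k" "x (Suc k)" "x k"] by (simp add: b1_def distrib_left)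
  have "energy u v (Suc k) = Q p q - 2 * inner p b2 + L * (norm (dx k))\<^sup>2"
    by (simp add: energy_def p_def q_def b2_def dx_def)
  moreover have "energy u v k = Q (p - dx k) (q - dy k) - 2 * inner p b1 + 2 * inner (dx k) b1
      + L * (norm (x (Suc k) - x k))\<^sup>2"
    unfolding energy_def x_eq y_eq b1_def by (simp add: inner_diff_left)
  ultimately show ?thesis
    using primal dual B cross unfolding Q_diff inner_diff_right[of "K p"] by argo
qed

lemma energy_lower_bound:
  "Q (x (Suc k) - u) (y k - v) - 2 * L * (norm (x (Suc k) - u))\<^sup>2 \<le> energy u v k"
proof -
  have "2 * inner (x (Suc k) - u) (B (x (Suc k)) - B (x k)) \<le>
      L * (norm (x (Suc k) - u))\<^sup>2 + L * (norm (x (Suc k) - x k))\<^sup>2"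
    using B_cross_term[of "x (Suc k) - u" "x (Suc k)" "x k"] by (simp add: distrib_left)
  moreover have "0 \<le> L * (norm (x (Suc k) - u))\<^sup>2"
    using L_nonneg by simp
  ultimately show ?thesis unfolding energy_def by linarith
qed

lemma energy_decseq_convergent:
  assumes "is_solution u v"
  shows "decseq (energy u v)" "convergent (energy u v)"
proof -
  obtain \<epsilon> where \<epsilon>: "\<epsilon> > 0"
    "\<And>u v. \<epsilon> * ((norm u)\<^sup>2 + (norm v)\<^sup>2) \<le> Q u v - 2 * L * (norm u)\<^sup>2"
    using Q_coercive by blast
  have nonneg: "0 \<le> Q u v - 2 * L * (norm u)\<^sup>2" for u v
  proof -
    have "0 \<le> \<epsilon> * ((norm u)\<^sup>2 + (norm v)\<^sup>2)" using \<epsilon>(1) by simp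
    then show ?thesis using \<epsilon>(2)[of u v] by linarith
  qed
  show dec: "decseq (energy u v)"
  proof (rule decseq_SucI)
    fix k show "energy u v (Suc k) \<le> energy u v k"
      using energy_descent[OF assms, of k] nonneg[of "x (Suc (Suc k)) - x (Suc k)" "y (Suc k) - y k"]
      by linarith
  qed
  have "0 \<le> energy u v k" for k
    using energy_lower_bound[of k u v] nonneg[of "x (Suc k) - u" "y k - v"] by linarith
  then show "convergent (energy u v)"
    using decseq_convergent[OF dec, of 0] by (metis convergentI)
qed

lemma increments_tendsto_zero:
  assumes "is_solution u v"
  shows "(\<lambda>k. x (Suc k) - x k) \<longlonglongrightarrow> 0" "(\<lambda>k. y (Suc k) - y k) \<longlonglongrightarrow> 0"
proof -
  obtain \<epsilon> where \<epsilon>: "\<epsilon> > 0"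
    "\<And>u v. \<epsilon> * ((norm u)\<^sup>2 + (norm v)\<^sup>2) \<le> Q u v - 2 * L * (norm u)\<^sup>2"
    using Q_coercive by blast
  obtain l where l: "energy u v \<longlonglongrightarrow> l"
    using energy_decseq_convergent(2)[OF assms] by (auto simp: convergent_def)
  have lim: "(\<lambda>k. energy u v k - energy u v (Suc k)) \<longlonglongrightarrow> 0"
    using tendsto_diff[OF l LIMSEQ_Suc[OF l]] by simp
  have "\<epsilon> * (norm (x (Suc (Suc k)) - x (Suc k)))\<^sup>2 \<le> energy u v k - energy u v (Suc k)"
    "\<epsilon> * (norm (y (Suc k) - y k))\<^sup>2 \<le> energy u v k - energy u v (Suc k)" for k
  proof -
    have "0 \<le> \<epsilon> * (norm (x (Suc (Suc k)) - x (Suc k)))\<^sup>2" "0 \<le> \<epsilon> * (norm (y (Suc k) - y k))\<^sup>2"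
      using \<epsilon>(1) by simp_all
    moreover have "\<epsilon> * (norm (x (Suc (Suc k)) - x (Suc k)))\<^sup>2 + \<epsilon> * (norm (y (Suc k) - y k))\<^sup>2
        \<le> energy u v k - energy u v (Suc k)"
      using energy_descent[OF assms, of k]
        \<epsilon>(2)[of "x (Suc (Suc k)) - x (Suc k)" "y (Suc k) - y k"]
      unfolding distrib_left by linarith
    ultimately show "\<epsilon> * (norm (x (Suc (Suc k)) - x (Suc k)))\<^sup>2 \<le> energy u v k - energy u v (Suc k)"
      "\<epsilon> * (norm (y (Suc k) - y k))\<^sup>2 \<le> energy u v k - energy u v (Suc k)" by linarith+
  qed
  note tendsto_zero_of_power2_le[OF this(1) \<epsilon>(1) lim] tendsto_zero_of_power2_le[OF this(2) \<epsilon>(1) lim]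
  then show "(\<lambda>k. x (Suc k) - x k) \<longlonglongrightarrow> 0" "(\<lambda>k. y (Suc k) - y k) \<longlonglongrightarrow> 0"
    using LIMSEQ_imp_Suc[of "\<lambda>k. x (Suc k) - x k"] by blast+
qed

lemma B_tendsto: "(f \<longlongrightarrow> u) F \<Longrightarrow> ((\<lambda>k. B (f k)) \<longlongrightarrow> B u) F"
  by (rule continuous_on_tendsto_compose[OF lipschitz_on_continuous_on[OF B_lipschitz]]) simp_all

lemma shifted_limits:
  assumes "is_solution u v" "strict_mono r"
    and "(\<lambda>k. x (Suc (r k))) \<longlonglongrightarrow> xs" "(\<lambda>k. y (r k)) \<longlonglongrightarrow> ys"
  shows "(\<lambda>k. x (r k)) \<longlonglongrightarrow> xs" "(\<lambda>k. x (Suc (Suc (r k)))) \<longlonglongrightarrow> xs"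
    "(\<lambda>k. y (Suc (r k))) \<longlonglongrightarrow> ys"
proof -
  note dx = increments_tendsto_zero(1)[OF assms(1)] and dy = increments_tendsto_zero(2)[OF assms(1)]
  show "(\<lambda>k. x (r k)) \<longlonglongrightarrow> xs"
    using tendsto_diff[OF assms(3) LIMSEQ_subseq_LIMSEQ[OF dx assms(2)]] by (simp add: o_def)
  show "(\<lambda>k. x (Suc (Suc (r k)))) \<longlonglongrightarrow> xs"
    using tendsto_add[OF assms(3) LIMSEQ_subseq_LIMSEQ[OF LIMSEQ_Suc[OF dx] assms(2)]]
    by (simp add: o_def)
  show "(\<lambda>k. y (Suc (r k))) \<longlonglongrightarrow> ys"
    using tendsto_add[OF assms(4) LIMSEQ_subseq_LIMSEQ[OF dy assms(2)]] by (simp add: o_def)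
qed

text \<open>
  Closedness of the graphs: the inequality that relates the iterates to any fixed element of the graph
  survives in the limit, and maximality turns it back into membership. Moving the adjoint to the
  other side of the inner product leaves only \<open>K\<close> and \<open>B\<close>, which are continuous.
\<close>

lemma cluster_point_is_solution:
  assumes "is_solution u v" "strict_mono r"
    and xr: "(\<lambda>k. x (Suc (r k))) \<longlonglongrightarrow> xs" and yr: "(\<lambda>k. y (r k)) \<longlonglongrightarrow> ys"
  shows "is_solution xs ys"
proof -
  note lims = xr yr shifted_limits[OF assms]
  have "- B xs - K' ys \<in> A xs"
  proof (rule maximally_monotone_maximalD[OF A_max])
    fix w a assume "a \<in> A w"
    define f where "f k = inner (x (Suc (Suc k)) - w)
        ((x (Suc k) - x (Suc (Suc k))) /\<^sub>R \<tau> - 2 *\<^sub>R B (x (Suc k)) + B (x k) - a)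
      - inner (K (x (Suc (Suc k)) - w)) (y k)" for k
    have "0 \<le> f k" for k
      using maximally_monotone_monotoneD[OF A_max x_step \<open>a \<in> A w\<close>, of k]
      by (simp add: f_def inner_add_right inner_diff_right flip: K_adjoint)
    moreover have "(\<lambda>k. f (r k)) \<longlonglongrightarrow> inner (xs - w)
        ((xs - xs) /\<^sub>R \<tau> - 2 *\<^sub>R B xs + B xs - a) - inner (K (xs - w)) ys"
      unfolding f_def by (intro tendsto_intros lims B_tendsto K.tendsto)
    ultimately have "0 \<le> inner (xs - w) ((xs - xs) /\<^sub>R \<tau> - 2 *\<^sub>R B xs + B xs - a) - inner (K (xs - w)) ys"
      by (intro LIMSEQ_le_const) auto
    then show "inner (xs - w) (- B xs - K' ys - a) \<ge> 0"
      by (simp add: inner_add_right inner_diff_right scaleR_2 flip: K_adjoint)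
  qed
  moreover have "K xs \<in> D ys"
  proof (rule maximally_monotone_maximalD[OF D_max])
    fix w a assume "a \<in> D w"
    have "(\<lambda>k. inner (y (Suc (r k)) - w) ((y (r k) - y (Suc (r k))) /\<^sub>R \<sigma>
          + K (2 *\<^sub>R x (Suc (Suc (r k))) - x (Suc (r k))) - a))
        \<longlonglongrightarrow> inner (ys - w) ((ys - ys) /\<^sub>R \<sigma> + K (2 *\<^sub>R xs - xs) - a)"
      by (intro tendsto_intros lims K.tendsto)
    then have "0 \<le> inner (ys - w) ((ys - ys) /\<^sub>R \<sigma> + K (2 *\<^sub>R xs - xs) - a)"
      by (rule LIMSEQ_le_const) (use maximally_monotone_monotoneD[OF D_max y_step \<open>a \<in> D w\<close>] in blast)
    then show "inner (ys - w) (K xs - a) \<ge> 0" by (simp add: scaleR_2)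
  qed
  ultimately show ?thesis by (simp add: is_solution_def)
qed

text \<open>
  The given solution only provides boundedness and a cluster point. The cluster point is then itself
  the solution with respect to which the energy is considered.
\<close>

theorem converges_to_solution:
  assumes "finite_dimensional TYPE('a)" "finite_dimensional TYPE('b)" "is_solution u v"
  shows "\<exists>xs ys. is_solution xs ys \<and> x \<longlonglongrightarrow> xs \<and> y \<longlonglongrightarrow> ys"
proof -
  obtain \<epsilon> where \<epsilon>: "\<epsilon> > 0"
    "\<And>u v. \<epsilon> * ((norm u)\<^sup>2 + (norm v)\<^sup>2) \<le> Q u v - 2 * L * (norm u)\<^sup>2"
    using Q_coercive by blast
  have x_le: "\<epsilon> * (norm (x (Suc k) - u))\<^sup>2 \<le> energy u v k"
    and y_le: "\<epsilon> * (norm (y k - v))\<^sup>2 \<le> energy u v k" for u v k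
  proof -
    have "0 \<le> \<epsilon> * (norm (x (Suc k) - u))\<^sup>2" "0 \<le> \<epsilon> * (norm (y k - v))\<^sup>2"
      using \<epsilon>(1) by simp_all
    moreover have "\<epsilon> * (norm (x (Suc k) - u))\<^sup>2 + \<epsilon> * (norm (y k - v))\<^sup>2 \<le> energy u v k"
      using energy_lower_bound[of k u v] \<epsilon>(2)[of "x (Suc k) - u" "y k - v"]
      unfolding distrib_left by linarith
    ultimately show "\<epsilon> * (norm (x (Suc k) - u))\<^sup>2 \<le> energy u v k"
      "\<epsilon> * (norm (y k - v))\<^sup>2 \<le> energy u v k" by linarith+
  qed
  define R where "R = sqrt (energy u v 0 / \<epsilon>)"
  have le_R: "t \<le> R" if "\<epsilon> * t\<^sup>2 \<le> energy u v k" for t k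
  proof -
    have "\<epsilon> * t\<^sup>2 \<le> energy u v 0"
      using that decseqD[OF energy_decseq_convergent(1)[OF assms(3)], of 0 k] by simp
    then show ?thesis
      unfolding R_def using \<epsilon>(1) by (intro real_le_rsqrt) (simp add: pos_le_divide_eq mult.commute)
  qed
  have bounded: "(x (Suc k), y k) \<in> cball u R \<times> cball v R" for k
    using le_R[OF x_le] le_R[OF y_le] by (simp add: dist_norm norm_minus_commute)
  have "compact (cball u R \<times> cball v R)"
    by (intro compact_Times finite_dimensional_compact assms closed_cball bounded_cball)
  then obtain z r where r: "strict_mono r" and z: "((\<lambda>k. (x (Suc k), y k)) \<circ> r) \<longlonglongrightarrow> z"
    using seq_compactE[OF compact_imp_seq_compact, of _ "\<lambda>k. (x (Suc k), y k)"] bounded by metis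
  define xs ys where "xs = fst z" and "ys = snd z"
  have lims: "(\<lambda>k. x (Suc (r k))) \<longlonglongrightarrow> xs" "(\<lambda>k. y (r k)) \<longlonglongrightarrow> ys"
    using tendsto_fst[OF z] tendsto_snd[OF z] by (simp_all add: o_def xs_def ys_def)
  have sol: "is_solution xs ys"
    by (rule cluster_point_is_solution[OF assms(3) r lims])
  have "(\<lambda>k. energy xs ys (r k)) \<longlonglongrightarrow> 0"
  proof -
    have "(\<lambda>k. energy xs ys (r k)) \<longlonglongrightarrow>
        ((norm (xs - xs))\<^sup>2 / \<tau> + (norm (ys - ys))\<^sup>2 / \<sigma> - 2 * inner (K (xs - xs)) (ys - ys))
        - 2 * inner (xs - xs) (B xs - B xs) + L * (norm (xs - xs))\<^sup>2"
      unfolding energy_def Q_def using tau_pos sigma_pos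
      by (intro tendsto_intros lims shifted_limits[OF assms(3) r lims] B_tendsto K.tendsto) auto
    then show ?thesis by simp
  qed
  moreover obtain l where l: "energy xs ys \<longlonglongrightarrow> l"
    using energy_decseq_convergent(2)[OF sol] by (auto simp: convergent_def)
  moreover have "(\<lambda>k. energy xs ys (r k)) \<longlonglongrightarrow> l"
    using LIMSEQ_subseq_LIMSEQ[OF l r] by (simp add: o_def)
  ultimately have lim0: "energy xs ys \<longlonglongrightarrow> 0"
    using LIMSEQ_unique by blast
  have "(\<lambda>k. x (Suc k) - xs) \<longlonglongrightarrow> 0"
    by (rule tendsto_zero_of_power2_le[OF x_le \<epsilon>(1) lim0])
  then have "x \<longlonglongrightarrow> xs"
    by (rule LIMSEQ_imp_Suc[OF LIM_zero_cancel])
  moreover have "(\<lambda>k. y k - ys) \<longlonglongrightarrow> 0"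
    by (rule tendsto_zero_of_power2_le[OF y_le \<epsilon>(1) lim0])
  then have "y \<longlonglongrightarrow> ys"
    by (simp add: LIM_zero_iff)
  ultimately show ?thesis using sol by blast
qed

end

section \<open>Convergence of the algorithm\<close>

theorem theorem3p3:
  fixes A :: "'a::real_inner \<Rightarrow> 'a set"
    and B :: "'a \<Rightarrow> 'a"
    and C :: "'b::real_inner \<Rightarrow> 'b set"
    and K :: "'a \<Rightarrow> 'b"
    and L \<tau> \<sigma> :: real
    and x :: "int \<Rightarrow> 'a"
    and y :: "int \<Rightarrow> 'b"
  assumes "finite_dimensional TYPE('a)"
    and "finite_dimensional TYPE('b)"
    and "maximally_monotone A"
    and "maximally_monotone C"
    and "monotone_operator (\<lambda>u. {B u})"
    and "L-lipschitz_on UNIV B"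
    and "linear K"
    and "\<exists>u. 0 \<in> (A u + {B u}) + adjoint K ` C (K u)"
    and "\<tau> > 0"
    and "\<sigma> > 0"
    and "2 * \<tau> * L + \<tau> * \<sigma> * (onorm K)\<^sup>2 < 1"
    and "x (- 1) = x 0"
    and "\<And>k. k \<ge> 0 \<Longrightarrow>
           x (k + 1) = resolvent (scale_operator \<tau> A)
             (x k - \<tau> *\<^sub>R adjoint K (y k) - (2 * \<tau>) *\<^sub>R B (x k) + \<tau> *\<^sub>R B (x (k - 1)))"
    and "\<And>k. k \<ge> 0 \<Longrightarrow>
           y (k + 1) = resolvent (scale_operator \<sigma> (inverse_operator C))
             (y k + \<sigma> *\<^sub>R K (2 *\<^sub>R x (k + 1) - x k))"
  shows "\<exists>xs ys. (\<lambda>k::nat. (x (int k), y (int k))) \<longlonglongrightarrow> (xs, ys) \<and>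
           0 \<in> A xs + {B xs} + {adjoint K ys} \<and>
           0 \<in> {- K xs} + inverse_operator C ys"
proof -
  let ?K' = "adjoint K"
  have K: "bounded_linear K"
    using assms by (intro finite_dimensional_bounded_linear)
  note adj = finite_dimensional_adjoint[OF assms(1,7)]
  \<comment> \<open>The shift makes \<open>X 0\<close> the initial value with index -1.\<close>
  define X where "X n = x (int n - 1)" for n
  define Y where "Y n = y (int n)" for n
  have X_simps: "X (Suc n) = x (int n)" "X (Suc (Suc n)) = x (int n + 1)" "Y (Suc n) = y (int n + 1)" for n
    by (simp_all add: X_def Y_def algebra_simps)
  interpret forward_reflected_primal_dual A B "inverse_operator C" K ?K' L \<tau> \<sigma> X Y
  proof (rule forward_reflected_primal_dual.intro)
    fix k
    note X_eqs = X_simps(1)[of k] X_simps(2)[of k] X_simps(3)[of k]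
    have "(x (int k) - \<tau> *\<^sub>R ?K' (y (int k)) - (2 * \<tau>) *\<^sub>R B (x (int k))
        + \<tau> *\<^sub>R B (x (int k - 1)) - x (int k + 1)) /\<^sub>R \<tau> \<in> A (x (int k + 1))"
      by (rule resolvent_scale_in[OF assms(1,3,9) assms(13)]) simp
    also have "(x (int k) - \<tau> *\<^sub>R ?K' (y (int k)) - (2 * \<tau>) *\<^sub>R B (x (int k))
        + \<tau> *\<^sub>R B (x (int k - 1)) - x (int k + 1)) /\<^sub>R \<tau> =
        (X (Suc k) - X (Suc (Suc k))) /\<^sub>R \<tau> - ?K' (Y k) - 2 *\<^sub>R B (X (Suc k)) + B (X k)"
      unfolding X_eqs unfolding X_def Y_def using \<open>\<tau> > 0\<close>
      by (simp add: scaleR_diff_right scaleR_add_right)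
    finally show "(X (Suc k) - X (Suc (Suc k))) /\<^sub>R \<tau> - ?K' (Y k) - 2 *\<^sub>R B (X (Suc k)) + B (X k)
        \<in> A (X (Suc (Suc k)))"
      by (simp only: X_eqs)
    have "(y (int k) + \<sigma> *\<^sub>R K (2 *\<^sub>R x (int k + 1) - x (int k)) - y (int k + 1)) /\<^sub>R \<sigma>
        \<in> inverse_operator C (y (int k + 1))"
      by (rule resolvent_scale_in[OF assms(2) maximally_monotone_inverse[OF assms(4)] assms(10) assms(14)]) simp
    also have "(y (int k) + \<sigma> *\<^sub>R K (2 *\<^sub>R x (int k + 1) - x (int k)) - y (int k + 1)) /\<^sub>R \<sigma> =
        (Y k - Y (Suc k)) /\<^sub>R \<sigma> + K (2 *\<^sub>R X (Suc (Suc k)) - X (Suc k))"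
      unfolding X_eqs unfolding Y_def using \<open>\<sigma> > 0\<close>
      by (simp add: scaleR_diff_right scaleR_add_right)
    finally show "(Y k - Y (Suc k)) /\<^sub>R \<sigma> + K (2 *\<^sub>R X (Suc (Suc k)) - X (Suc k))
        \<in> inverse_operator C (Y (Suc k))"
      by (simp only: X_eqs)
  qed (fact assms K adj maximally_monotone_inverse[OF assms(4)])+
  have solution_iff: "is_solution u v \<longleftrightarrow>
      0 \<in> A u + {B u} + {?K' v} \<and> 0 \<in> {- K u} + inverse_operator C v" for u v
  proof -
    have "0 \<in> A u + {B u} + {?K' v} \<longleftrightarrow> - B u - ?K' v \<in> A u"
    proof
      assume "0 \<in> A u + {B u} + {?K' v}"
      then obtain a where "a \<in> A u" "0 = a + B u + ?K' v"
        by (auto simp: set_plus_def)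
      moreover from this(2) have "a = - B u - ?K' v"
        by (simp add: eq_neg_iff_add_eq_0 algebra_simps)
      ultimately show "- B u - ?K' v \<in> A u" by simp
    next
      assume "- B u - ?K' v \<in> A u"
      then have "(- B u - ?K' v) + B u + ?K' v \<in> A u + {B u} + {?K' v}"
        by (intro set_plus_intro) auto
      then show "0 \<in> A u + {B u} + {?K' v}" by simp
    qed
    moreover have "0 \<in> {- K u} + inverse_operator C v \<longleftrightarrow> K u \<in> inverse_operator C v"
      by (auto simp: set_plus_def)
    ultimately show ?thesis by (simp add: is_solution_def)
  qed
  obtain u c where "0 \<in> A u + {B u} + {?K' c}" "c \<in> C (K u)"
    using assms(8) by (auto simp: set_plus_def)
  moreover from this(2) have "0 \<in> {- K u} + inverse_operator C c"
    by (auto simp: set_plus_def inverse_operator_def)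
  ultimately have "is_solution u c"
    by (simp add: solution_iff)
  from converges_to_solution[OF assms(1,2) this] obtain xs ys
    where sol: "is_solution xs ys" and lim: "X \<longlonglongrightarrow> xs" "Y \<longlonglongrightarrow> ys" by blast
  have "(\<lambda>k. (x (int k), y (int k))) \<longlonglongrightarrow> (xs, ys)"
    using tendsto_Pair[OF LIMSEQ_Suc[OF lim(1)] lim(2)] by (simp add: X_simps Y_def)
  then show ?thesis using sol solution_iff by blast
qed

end
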